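(* Assume that $a_{ij}>0$ for all $i\in N$, $j\in M$ (MAC). Let $v^*\in V$. (i) If the Pareto face $F_{v^*}$ contains a point of the egalitarian ray, then $\tilde g(v^* )\le\tilde g(v)$ for every $v\in V$. (ii) If $\tilde g(v^* )\le\tilde g(v')$ for every $v'\in V$ adjacent to $v^*$ in $\mathcal G$, then $F_{v^*}$ contains a point of the egalitarian ray (and hence $\tilde g(v^* )\le\tilde g(v)$ for every $v\in V$).
   Context: Setting. $N=\{1,2,3\}$ is the set of players and $M=\{1,\dots,m\}$ ($m\ge1$) the set of divisible homogeneous goods (items). $a_{ij}$ is the value of good $j$ to player $i$, with $\sum_{j\in M}a_{ij}=1$ for each $i$. An allocation is a matrix $\mathbf X=(x_{ij})_{i\in N,j\in M}$ with $x_{ij}\ge0$ and $\sum_{i\in N}x_{ij}=1$ for all $j$. Put $a_i(\mathbf X)=\sum_{j}a_{ij}x_{ij}$ and $a(\mathbf X)=(a_i(\mathbf X))_{i\in N}\in\mathbb R^3$. $IPS=\{a(\mathbf X):\mathbf X\text{ an allocation}\}$. The egalitarian ray is $\{t(1,1,1):t\ge0\}$. $\Delta_2=\{x\in\mathbb R^3: x_i\ge0,\ x_1+x_2+x_3=1\}$, and $\mathring\Delta_2$ is the subset with all $x_i>0$. For $x\in\mathbb R^3_+\setminus\{0\}$, $N(x)=x/(x_1+x_2+x_3)$. For $x\in\mathring\Delta_2$, $RD(x)=N(1/x_1,1/x_2,1/x_3)$. For $\gamma\in\Delta_2$, $g(\gamma)=\max_{y\in IPS}\sum_i\gamma_iy_i=\sum_{j\in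 M}\max_{i\in N}\gamma_ia_{ij}$, and $\mathcal H(\gamma)=\{x\in\mathbb R^3:\sum_i\gamma_ix_i=g(\gamma)\}$. For $\beta\in\mathring\Delta_2$, $\tilde g(\beta)=g(RD(\beta))$. $RNS$ is the simplex $\Delta_2$, in which the vertex $e_i$ represents player $i$ and each good $j$ is plotted at $a^n_j=N(a_{1j},a_{2j},a_{3j})$. The supporting segments of a good $j$ are the three segments joining $a^n_j$ to the three vertices of the simplex. Two goods are s-independent if neither of their plotted points lies on a supporting segment of the other. The graph $\mathcal G=(V,E)$: $V$ is the set of points of $RNS$ that coincide with some $a^n_j$, or are an intersection point, other than a vertex of the simplex, of supporting segments of two s-independent goods. Two distinct points of $V$ are joined by an arc (are adjacent) if both lie on a common supporting segment of some good with no other point of $V$ strictly between them. Each $v\in V$ represents the Pareto face $F_v=IPS\cap\mathcal H(RD(v))$ (a two-dimensional face of $IPS$ made of values of Pareto optimal allocations). *)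

theory Defs
  imports "HOL-Analysis.Analysis"
begin

text \<open>
  Players are the elements of the three-element type \<open>3\<close>, goods those of an arbitrary finite
  (hence nonempty) type. Valuations and allocations are matrices with one row per player:
  \<open>a $ i $ j\<close> is the value of good \<open>j\<close> to player \<open>i\<close>.
\<close>

definition is_allocation :: "real ^ 'm::finite ^ 3 \<Rightarrow> bool" where
  "is_allocation X \<longleftrightarrow> (\<forall>i j. 0 \<le> X $ i $ j) \<and> (\<forall>j. (\<Sum>i\<in>UNIV. X $ i $ j) = 1)"

definition utility :: "real ^ 'm::finite ^ 3 \<Rightarrow> real ^ 'm ^ 3 \<Rightarrow> real ^ 3" where
  "utility a X = (\<chi> i. \<Sum>j\<in>UNIV. a $ i $ j * X $ i $ j)"

definition IPS :: "real ^ 'm::finite ^ 3 \<Rightarrow> (real ^ 3) set" where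
  "IPS a = {utility a X | X. is_allocation X}"

definition egalitarian_ray :: "(real ^ 3) set" where
  "egalitarian_ray = {t *\<^sub>R (\<chi> i. 1) | t. 0 \<le> t}"

definition RNS :: "(real ^ 3) set" where
  "RNS = {x. (\<forall>i. 0 \<le> x $ i) \<and> (\<Sum>i\<in>UNIV. x $ i) = 1}"

definition normalize_vec :: "real ^ 3 \<Rightarrow> real ^ 3" where
  "normalize_vec x = (\<chi> i. x $ i / (\<Sum>k\<in>UNIV. x $ k))"

text \<open>Only meaningful at points with all coordinates positive.\<close>

definition RD :: "real ^ 3 \<Rightarrow> real ^ 3" where
  "RD x = normalize_vec (\<chi> i. 1 / x $ i)"

text \<open>
  The supremum below is a maximum, given by an explicit formula; see
  \<open>support_value_eq\<close>, \<open>support_value_upper\<close> and \<open>support_value_attained\<close>.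
\<close>

definition support_value :: "real ^ 'm::finite ^ 3 \<Rightarrow> real ^ 3 \<Rightarrow> real" where
  "support_value a \<gamma> = (SUP y\<in>IPS a. \<Sum>i\<in>UNIV. \<gamma> $ i * y $ i)"

definition support_plane :: "real ^ 'm::finite ^ 3 \<Rightarrow> real ^ 3 \<Rightarrow> (real ^ 3) set" where
  "support_plane a \<gamma> = {x. (\<Sum>i\<in>UNIV. \<gamma> $ i * x $ i) = support_value a \<gamma>}"

definition g_tilde :: "real ^ 'm::finite ^ 3 \<Rightarrow> real ^ 3 \<Rightarrow> real" where
  "g_tilde a \<beta> = support_value a (RD \<beta>)"

definition good_point :: "real ^ 'm::finite ^ 3 \<Rightarrow> 'm \<Rightarrow> real ^ 3" where
  "good_point a j = normalize_vec (\<chi> i. a $ i $ j)"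

definition supporting_segment :: "real ^ 'm::finite ^ 3 \<Rightarrow> 'm \<Rightarrow> 3 \<Rightarrow> (real ^ 3) set" where
  "supporting_segment a j i = closed_segment (good_point a j) (axis i 1)"

definition s_independent :: "real ^ 'm::finite ^ 3 \<Rightarrow> 'm \<Rightarrow> 'm \<Rightarrow> bool" where
  "s_independent a j k \<longleftrightarrow>
     (\<forall>i. good_point a j \<notin> supporting_segment a k i \<and> good_point a k \<notin> supporting_segment a j i)"

definition graph_vertices :: "real ^ 'm::finite ^ 3 \<Rightarrow> (real ^ 3) set" where
  "graph_vertices a =
     {v \<in> RNS. (\<exists>j. v = good_point a j) \<or>
        (\<exists>j k i l. s_independent a j k \<and> v \<in> supporting_segment a j i \<inter> supporting_segment a k l
           \<and> (\<forall>p. v \<noteq> axis p 1))}"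

definition graph_adjacent :: "real ^ 'm::finite ^ 3 \<Rightarrow> real ^ 3 \<Rightarrow> real ^ 3 \<Rightarrow> bool" where
  "graph_adjacent a v w \<longleftrightarrow>
     v \<in> graph_vertices a \<and> w \<in> graph_vertices a \<and> v \<noteq> w \<and>
     (\<exists>j i. v \<in> supporting_segment a j i \<and> w \<in> supporting_segment a j i) \<and>
     open_segment v w \<inter> graph_vertices a = {}"

definition pareto_face :: "real ^ 'm::finite ^ 3 \<Rightarrow> real ^ 3 \<Rightarrow> (real ^ 3) set" where
  "pareto_face a v = IPS a \<inter> support_plane a (RD v)"

lemma weighted_utility:
  "(\<Sum>i\<in>UNIV. \<gamma> $ i * utility a X $ i) = (\<Sum>j\<in>UNIV. \<Sum>i\<in>UNIV. (\<gamma> $ i * a $ i $ j) * X $ i $ j)"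
proof -
  have "(\<Sum>i\<in>UNIV. \<gamma> $ i * utility a X $ i)
      = (\<Sum>i\<in>UNIV. \<Sum>j\<in>UNIV. (\<gamma> $ i * a $ i $ j) * X $ i $ j)"
    by (simp add: utility_def sum_distrib_left mult.assoc)
  also have "\<dots> = (\<Sum>j\<in>UNIV. \<Sum>i\<in>UNIV. (\<gamma> $ i * a $ i $ j) * X $ i $ j)"
    by (rule sum.swap)
  finally show ?thesis .
qed

lemma weighted_utility_le:
  assumes "y \<in> IPS a"
  shows "(\<Sum>i\<in>UNIV. \<gamma> $ i * y $ i) \<le> (\<Sum>j\<in>UNIV. MAX i. \<gamma> $ i * a $ i $ j)"
proof -
  obtain X where X: "is_allocation X" "y = utility a X"
    using assms by (auto simp: IPS_def)
  have "(\<Sum>i\<in>UNIV. (\<gamma> $ i * a $ i $ j) * X $ i $ j) \<le> (MAX i. \<gamma> $ i * a $ i $ j)" for j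
  proof -
    have "(\<Sum>i\<in>UNIV. (\<gamma> $ i * a $ i $ j) * X $ i $ j)
        \<le> (\<Sum>i\<in>UNIV. (MAX i. \<gamma> $ i * a $ i $ j) * X $ i $ j)"
      using X(1) by (intro sum_mono mult_right_mono) (auto simp: is_allocation_def)
    also have "\<dots> = (MAX i. \<gamma> $ i * a $ i $ j) * (\<Sum>i\<in>UNIV. X $ i $ j)"
      by (rule sum_distrib_left [symmetric])
    also have "\<dots> = (MAX i. \<gamma> $ i * a $ i $ j)"
      using X(1) by (simp add: is_allocation_def)
    finally show ?thesis .
  qed
  then show ?thesis
    unfolding X(2) weighted_utility by (intro sum_mono) 
qed

lemma weighted_utility_attained:
  "\<exists>y\<in>IPS a. (\<Sum>i\<in>UNIV. \<gamma> $ i * y $ i) = (\<Sum>j\<in>UNIV. MAX i. \<gamma> $ i * a $ i $ j)"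
proof -
  have "\<exists>p. \<gamma> $ p * a $ p $ j = (MAX i. \<gamma> $ i * a $ i $ j)" for j
  proof -
    have "(MAX i. \<gamma> $ i * a $ i $ j) \<in> range (\<lambda>i. \<gamma> $ i * a $ i $ j)"
      by (intro Max_in) auto
    then show ?thesis by (metis (no_types, lifting) rangeE)
  qed
  then obtain p where p: "\<And>j. \<gamma> $ p j * a $ p j $ j = (MAX i. \<gamma> $ i * a $ i $ j)"
    by metis
  define X :: "real ^ 'a ^ 3" where "X = (\<chi> i j. if i = p j then 1 else 0)"
  have "is_allocation X"
    by (simp add: is_allocation_def X_def)
  moreover have "(\<Sum>i\<in>UNIV. \<gamma> $ i * utility a X $ i) = (\<Sum>j\<in>UNIV. MAX i. \<gamma> $ i * a $ i $ j)"
    unfolding weighted_utility p [symmetric] by (simp add: X_def if_distrib cong: if_cong)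
  ultimately show ?thesis
    by (auto simp: IPS_def)
qed

lemma support_value_eq: "support_value a \<gamma> = (\<Sum>j\<in>UNIV. MAX i. \<gamma> $ i * a $ i $ j)"
proof -
  obtain y where "y \<in> IPS a" "(\<Sum>i\<in>UNIV. \<gamma> $ i * y $ i) = (\<Sum>j\<in>UNIV. MAX i. \<gamma> $ i * a $ i $ j)"
    using weighted_utility_attained by blast
  then show ?thesis
    unfolding support_value_def
    by (intro cSup_eq_maximum) (auto intro: weighted_utility_le rev_image_eqI)
qed

lemma support_value_upper:
  "y \<in> IPS a \<Longrightarrow> (\<Sum>i\<in>UNIV. \<gamma> $ i * y $ i) \<le> support_value a \<gamma>"
  unfolding support_value_eq by (rule weighted_utility_le)

lemma support_value_attained:
  "\<exists>y\<in>IPS a. (\<Sum>i\<in>UNIV. \<gamma> $ i * y $ i) = support_value a \<gamma>"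
  unfolding support_value_eq by (rule weighted_utility_attained)

end

theory Submission
  imports Defs
begin

text \<open>
  Write \<open>G = g_tilde v\<close>, and call a player best for a good at \<open>v\<close> if she maximises
  \<open>a\<^sub>p\<^sub>j / v\<^sub>p\<close>; let \<open>M\<^sub>j\<close> be this maximum. The allocations supported by \<open>v\<close> give each good
  to its best players, and such an allocation is egalitarian iff player \<open>p\<close> receives goods of
  total weight \<open>G / v\<^sub>p\<close>, good \<open>j\<close> having weight \<open>M\<^sub>j\<close>. This is a transportation problem, so by a
  Hall-type criterion it suffices that the goods for which some member of \<open>S\<close> is best weigh at
  least \<open>G (\<Sum>p\<in>S. 1 / v\<^sub>p)\<close>, for every set \<open>S\<close> of one or two players.

  With \<open>\<gamma>\<^sub>p = 1 / v\<^sub>p\<close>, the excess for \<open>S = {i}\<close> and for \<open>S = - {i}\<close> is the slope of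
  \<open>g(\<gamma>) - G (\<gamma>\<^sub>1 + \<gamma>\<^sub>2 + \<gamma>\<^sub>3)\<close> when \<open>\<gamma>\<^sub>i\<close> is increased or decreased. If the graph has an arc in
  this direction, the function is linear along it and local minimality gives the sign; if a segment
  runs to the corner without meeting a vertex, the sign is automatic. Directions without a
  supporting segment follow from the others, because the excess is modular up to goods that
  would produce such a segment, and at a vertex enough segments meet.
\<close>

section \<open>Case analysis over the three players\<close>

lemma UNIV_3_distinct:
  fixes i k l :: 3
  assumes "i \<noteq> k" "i \<noteq> l" "k \<noteq> l"
  shows "UNIV = {i, k, l}"
proof -
  have "card {i, k, l} = card (UNIV :: 3 set)"
    using assms by simp
  then show ?thesis
    by (metis card_subset_eq finite subset_UNIV)
qed

lemma other_players:
  fixes i :: 3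
  obtains k l where "i \<noteq> k" "i \<noteq> l" "k \<noteq> l"
proof -
  have "card (UNIV - {i}) = 2"
    by simp
  then obtain k l where "UNIV - {i} = {k, l}" "k \<noteq> l"
    by (meson card_2_iff)
  then show thesis
    using that by blast
qed

lemma third_player:
  fixes i k :: 3
  assumes "i \<noteq> k"
  obtains l where "i \<noteq> l" "k \<noteq> l"
  using other_players [of i] assms by metis

lemma sorted_players:
  fixes \<delta> :: "3 \<Rightarrow> real"
  obtains i k l where "i \<noteq> k" "i \<noteq> l" "k \<noteq> l" "\<delta> k \<le> \<delta> i" "\<delta> l \<le> \<delta> k"
proof -
  have "Max (range \<delta>) \<in> range \<delta>"
    by (intro Max_in) auto
  then obtain i where "\<delta> i = Max (range \<delta>)"
    by (metis rangeE)
  then have i: "\<delta> p \<le> \<delta> i" for p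
    by simp
  obtain k l where "i \<noteq> k" "i \<noteq> l" "k \<noteq> l"
    using other_players by blast
  then show thesis
    using that [of i k l] that [of i l k] i by (metis linorder_le_cases)
qed

section \<open>Best players, and \<open>g_tilde\<close> in terms of top ratios\<close>

definition best_for :: "real ^ 'm::finite ^ 3 \<Rightarrow> real ^ 3 \<Rightarrow> 3 \<Rightarrow> 'm \<Rightarrow> bool" where
  "best_for a x p j \<longleftrightarrow> (\<forall>q. a $ q $ j / x $ q \<le> a $ p $ j / x $ p)"

definition top_ratio :: "real ^ 'm::finite ^ 3 \<Rightarrow> real ^ 3 \<Rightarrow> 'm \<Rightarrow> real" where
  "top_ratio a x j = (MAX q. a $ q $ j / x $ q)"

lemma ratio_le_top_ratio: "a $ q $ j / x $ q \<le> top_ratio a x j"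
  unfolding top_ratio_def by (intro Max_ge) auto

lemma best_for_iff: "best_for a x p j \<longleftrightarrow> a $ p $ j / x $ p = top_ratio a x j"
proof
  assume "best_for a x p j"
  then show "a $ p $ j / x $ p = top_ratio a x j"
    unfolding top_ratio_def best_for_def by (intro Max_eqI [symmetric]) auto
qed (metis best_for_def ratio_le_top_ratio)

lemma ex_best_for: "\<exists>p. best_for a x p j"
proof -
  have "top_ratio a x j \<in> range (\<lambda>q. a $ q $ j / x $ q)"
    unfolding top_ratio_def by (intro Max_in) auto
  then show ?thesis
    by (auto simp: best_for_iff)
qed

text \<open>Scaling \<open>x\<close> divides all ratios by the same constant. Together with
  \<open>g_tilde_scaleR\<close> this lets unnormalised points such as \<open>shift v i s\<close>
  stand in for points of the simplex.\<close>

lemma best_for_scaleR: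
  assumes "0 < c"
  shows "best_for a (c *\<^sub>R x) p j \<longleftrightarrow> best_for a x p j"
proof -
  have "a $ q $ j / (c * x $ q) \<le> a $ p $ j / (c * x $ p) \<longleftrightarrow> a $ q $ j / x $ q \<le> a $ p $ j / x $ p" for q
  proof -
    have "a $ r $ j / (c * x $ r) = (a $ r $ j / x $ r) / c" for r
      by simp
    then show ?thesis
      using assms divide_le_cancel by (metis not_less_iff_gr_or_eq)
  qed
  then show ?thesis
    by (simp add: best_for_def)
qed

lemma normalize_vec_scaleR: "normalize_vec x = (1 / (\<Sum>k\<in>UNIV. x $ k)) *\<^sub>R x"
  by (simp add: normalize_vec_def vec_eq_iff)

lemma sum_pos_vec: "(\<And>i. 0 < x $ i) \<Longrightarrow> 0 < (\<Sum>i\<in>UNIV. x $ i)" for x :: "real ^ 3"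
  by (intro sum_pos) auto

lemma normalize_vec_pos: "(\<And>i. 0 < x $ i) \<Longrightarrow> 0 < normalize_vec x $ i"
  by (simp add: normalize_vec_def sum_pos_vec)

lemma sum_normalize_vec: "(\<And>i. 0 < x $ i) \<Longrightarrow> (\<Sum>i\<in>UNIV. normalize_vec x $ i) = 1"
  using sum_pos_vec [of x] by (simp add: normalize_vec_def flip: sum_divide_distrib)

lemma RD_component: "RD x $ i = (1 / x $ i) / (\<Sum>k\<in>UNIV. 1 / x $ k)"
  by (simp add: RD_def normalize_vec_def)

lemma sum_RD: "(\<And>i. 0 < x $ i) \<Longrightarrow> (\<Sum>i\<in>UNIV. RD x $ i) = 1"
  unfolding RD_def by (rule sum_normalize_vec) auto

text \<open>\<open>RD x\<close> is the vector of reciprocals \<open>1 / x $ i\<close> divided by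
  their sum, and this positive factor pulls out of each maximum.\<close>

lemma g_tilde_eq:
  assumes "\<And>i. 0 < x $ i"
  shows "g_tilde a x = (\<Sum>j\<in>UNIV. top_ratio a x j) / (\<Sum>i\<in>UNIV. 1 / x $ i)"
proof -
  define C where "C = (\<Sum>i\<in>UNIV. 1 / x $ i)"
  have C: "0 < C"
    unfolding C_def using assms by (intro sum_pos) auto
  have "(MAX i. RD x $ i * a $ i $ j) = top_ratio a x j / C" for j
  proof (rule Max_eqI)
    show "y \<le> top_ratio a x j / C" if "y \<in> range (\<lambda>i. RD x $ i * a $ i $ j)" for y
      using that C divide_right_mono [OF ratio_le_top_ratio [of a _ j x], of C]
      by (auto simp: RD_component simp flip: C_def)
    obtain p where "top_ratio a x j = a $ p $ j / x $ p"
      using ex_best_for best_for_iff by metis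
    then have "top_ratio a x j / C = RD x $ p * a $ p $ j"
      by (simp add: RD_component flip: C_def)
    then show "top_ratio a x j / C \<in> range (\<lambda>i. RD x $ i * a $ i $ j)"
      by simp
  qed simp
  then show ?thesis
    by (simp add: g_tilde_def support_value_eq C_def flip: sum_divide_distrib)
qed

lemma g_tilde_scaleR: "0 < c \<Longrightarrow> g_tilde a (c *\<^sub>R x) = g_tilde a x"
proof -
  assume c: "0 < c"
  have "(\<Sum>k\<in>UNIV. 1 / (c * x $ k)) = (\<Sum>k\<in>UNIV. 1 / x $ k) / c"
    by (simp add: sum_divide_distrib mult.commute)
  then have "RD (c *\<^sub>R x) = RD x"
    using c by (simp add: vec_eq_iff RD_component)
  then show ?thesis
    by (simp add: g_tilde_def)
qed

text \<open>The point lies on a supporting segment ending at the corner of player \<open>i\<close>.\<close>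

definition tied_away :: "real ^ 'm::finite ^ 3 \<Rightarrow> real ^ 3 \<Rightarrow> 3 \<Rightarrow> bool" where
  "tied_away a x i \<longleftrightarrow> (\<exists>j. \<forall>p. p \<noteq> i \<longrightarrow> best_for a x p j)"

text \<open>
  Multiplies the weight \<open>1 / x\<^sub>i\<close> of player \<open>i\<close> by \<open>s\<close>. After normalisation this moves along the
  line through the corner of player \<open>i\<close>, towards it for \<open>s < 1\<close>.
\<close>

definition shift :: "real ^ 3 \<Rightarrow> 3 \<Rightarrow> real \<Rightarrow> real ^ 3" where
  "shift x i s = (\<chi> p. if p = i then x $ i / s else x $ p)"

lemma shift_nth: "shift x i s $ p = (if p = i then x $ i / s else x $ p)"
  by (simp add: shift_def)

lemma shift_pos: "(\<And>p. 0 < x $ p) \<Longrightarrow> 0 < s \<Longrightarrow> 0 < shift x i s $ p"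
  by (simp add: shift_nth)

section \<open>Compactness and convexity of \<open>IPS\<close> and of its faces\<close>

lemma compact_allocations: "compact {X :: real ^ 'm::finite ^ 3. is_allocation X}"
proof -
  have "X $ i $ j \<le> 1" if "is_allocation X" for X :: "real ^ 'm ^ 3" and i j
    using that member_le_sum [of i UNIV "\<lambda>i. X $ i $ j"] by (auto simp: is_allocation_def)
  then have *: "norm (X $ i $ j) \<le> 1" if "is_allocation X" for X :: "real ^ 'm ^ 3" and i j
    using that by (auto simp: is_allocation_def)
  have "norm (X $ i) \<le> real CARD('m)" if "is_allocation X" for X :: "real ^ 'm ^ 3" and i
  proof -
    have "norm (X $ i) \<le> (\<Sum>j\<in>UNIV. norm (X $ i $ j))"
      by (simp add: norm_vec_def L2_set_le_sum)
    also have "\<dots> \<le> (\<Sum>j\<in>(UNIV :: 'm set). 1)"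
      using * [OF that] by (intro sum_mono) auto
    finally show ?thesis by simp
  qed
  note ** = this
  have "norm X \<le> 3 * real CARD('m)" if "is_allocation X" for X :: "real ^ 'm ^ 3"
  proof -
    have "norm X \<le> (\<Sum>i\<in>UNIV. norm (X $ i))"
      by (simp add: norm_vec_def L2_set_le_sum)
    also have "\<dots> \<le> (\<Sum>i\<in>(UNIV :: 3 set). real CARD('m))"
      using ** [OF that] by (intro sum_mono) auto
    finally show ?thesis by simp
  qed
  then have "bounded {X :: real ^ 'm ^ 3. is_allocation X}"
    by (auto simp: bounded_iff)
  moreover have "closed {X :: real ^ 'm ^ 3. is_allocation X}"
    unfolding is_allocation_def
    by (intro closed_Collect_conj closed_Collect_all closed_Collect_le closed_Collect_eq continuous_intros)
  ultimately show ?thesis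
    by (simp add: compact_eq_bounded_closed)
qed

lemma linear_utility: "linear (utility a)"
  by (rule linearI)
    (simp_all add: utility_def vec_eq_iff distrib_left sum.distrib sum_distrib_left mult.left_commute)

lemma IPS_image: "IPS a = utility a ` {X. is_allocation X}"
  by (auto simp: IPS_def)

lemma compact_IPS: "compact (IPS a)"
  unfolding IPS_image
  by (intro compact_continuous_image compact_allocations linear_continuous_on
      linear_conv_bounded_linear [THEN iffD1] linear_utility)

lemma convex_IPS: "convex (IPS a)"
proof -
  have "convex {X :: real ^ 'a ^ 3. is_allocation X}"
    by (rule convexI) (auto simp: is_allocation_def sum.distrib simp flip: sum_distrib_left)
  then show ?thesis
    unfolding IPS_image by (rule convex_linear_image [OF linear_utility])
qed

lemma support_plane_inner: "support_plane a \<gamma> = {x. \<gamma> \<bullet> x = support_value a \<gamma>}"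
  by (simp add: support_plane_def inner_vec_def)

text \<open>Convexity and closedness of the face serve the separation argument in
  \<open>egalitarian_if_demand\<close>.\<close>

lemma convex_pareto_face: "convex (pareto_face a v)"
  unfolding pareto_face_def support_plane_inner
  by (intro convex_Int convex_IPS convex_hyperplane)

lemma closed_pareto_face: "closed (pareto_face a v)"
  unfolding pareto_face_def support_plane_inner
  by (intro closed_Int compact_imp_closed compact_IPS closed_hyperplane)


section \<open>Supporting segments and graph vertices described by best players\<close>

lemma closed_segment_axis_nth:
  fixes p :: "real ^ 3"
  shows "((1 - t) *\<^sub>R p + t *\<^sub>R axis i 1) $ q = (1 - t) * p $ q + (if q = i then t else 0)"
  by (simp add: axis_def)

locale positive_valuation =
  fixes a :: "real ^ 'm::finite ^ 3"
  assumes valuation_pos: "0 < a $ i $ j"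
begin

lemma good_point_eq: "good_point a j = (1 / (\<Sum>k\<in>UNIV. a $ k $ j)) *\<^sub>R (\<chi> i. a $ i $ j)"
  by (simp add: good_point_def normalize_vec_scaleR)

lemma good_point_pos: "0 < good_point a j $ i"
  unfolding good_point_def by (rule normalize_vec_pos) (simp add: valuation_pos)

lemma sum_good_point: "(\<Sum>i\<in>UNIV. good_point a j $ i) = 1"
  unfolding good_point_def by (rule sum_normalize_vec) (simp add: valuation_pos)

lemma good_value_pos: "0 < (\<Sum>k\<in>UNIV. a $ k $ j)"
  by (intro sum_pos) (auto simp: valuation_pos)

lemma top_ratio_pos: "(\<And>p. 0 < x $ p) \<Longrightarrow> 0 < top_ratio a x j"
  using ratio_le_top_ratio [of a 1 j x] valuation_pos [of 1 j] by (smt (verit) divide_pos_pos)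

lemma g_tilde_nonneg: "(\<And>p. 0 < x $ p) \<Longrightarrow> 0 \<le> g_tilde a x"
  by (simp add: g_tilde_eq sum_nonneg top_ratio_pos less_imp_le)

text \<open>Moving from the good's point towards corner \<open>i\<close> keeps the coordinates of
  the other players proportional to their values and adds only to that of \<open>i\<close>. So the
  others share one ratio, and the ratio of \<open>i\<close> is at most that.\<close>

lemma mem_supporting_segment_iff:
  assumes x: "\<And>i. 0 < x $ i" "(\<Sum>i\<in>UNIV. x $ i) = 1"
  shows "x \<in> supporting_segment a j i \<longleftrightarrow> (\<forall>p. p \<noteq> i \<longrightarrow> best_for a x p j)"
proof
  let ?s = "\<Sum>k\<in>UNIV. a $ k $ j"
  obtain k where k: "k \<noteq> i"
    using other_players [of i] by metis
  assume "x \<in> supporting_segment a j i"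
  then obtain t where t: "0 \<le> t" "t \<le> 1" "x = (1 - t) *\<^sub>R good_point a j + t *\<^sub>R axis i 1"
    by (auto simp: supporting_segment_def in_segment)
  have x_eq: "x $ q = (1 - t) * a $ q $ j / ?s + (if q = i then t else 0)" for q
    unfolding t(3) closed_segment_axis_nth by (simp add: good_point_eq)
  \<comment> \<open>At \<open>t = 1\<close> the point would be the corner, where the coordinate of
    \<open>k\<close> vanishes.\<close>
  have "0 < 1 - t"
    using x(1) [of k] x_eq [of k] k t(2) by (cases "t = 1") auto
  have le: "a $ q $ j / x $ q \<le> ?s / (1 - t)" for q
  proof -
    have "(1 - t) * a $ q $ j / ?s \<le> x $ q"
      using x_eq [of q] t(1) by simp
    then show ?thesis
      using \<open>0 < 1 - t\<close> good_value_pos [of j] x(1) [of q] by (simp add: field_simps)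
  qed
  have "a $ p $ j / x $ p = ?s / (1 - t)" if "p \<noteq> i" for p
    using that x_eq [of p] \<open>0 < 1 - t\<close> good_value_pos [of j] valuation_pos [of p j]
    by simp
  with le show "\<forall>p. p \<noteq> i \<longrightarrow> best_for a x p j"
    by (auto simp: best_for_def)
next
  let ?s = "\<Sum>k\<in>UNIV. a $ k $ j"
  assume best: "\<forall>p. p \<noteq> i \<longrightarrow> best_for a x p j"
  obtain k l where kl: "i \<noteq> k" "i \<noteq> l" "k \<noteq> l"
    using other_players by blast
  define r where "r = top_ratio a x j"
  have eq: "a $ p $ j = r * x $ p" if "p \<noteq> i" for p
    using best that x(1) [of p] by (auto simp: best_for_iff r_def field_simps)
  have le: "a $ p $ j \<le> r * x $ p" for p
    using ratio_le_top_ratio [of a p j x] x(1) [of p] by (simp add: r_def field_simps)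
  have "0 < r"
    using eq [of k] kl valuation_pos [of k j] x(1) [of k] by (metis zero_less_mult_pos2)
  have "?s \<le> (\<Sum>p\<in>UNIV. r * x $ p)"
    by (intro sum_mono le)
  also have "\<dots> = r"
    by (simp add: x(2) flip: sum_distrib_left)
  finally have "?s \<le> r" .
  \<comment> \<open>The players other than \<open>i\<close> share the ratio \<open>r\<close>, so the
    good's point has to be scaled by \<open>?s / r\<close>, which forces this
    \<open>t\<close>.\<close>
  define t where "t = 1 - ?s / r"
  have t: "0 \<le> t" "t \<le> 1"
    using \<open>?s \<le> r\<close> \<open>0 < r\<close> good_value_pos [of j] by (auto simp: t_def)
  have "x $ i = a $ i $ j / r + t"
  proof -
    have "x $ i = 1 - x $ k - x $ l" "?s = a $ i $ j + a $ k $ j + a $ l $ j"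
      using x(2) kl by (simp_all add: UNIV_3_distinct [OF kl])
    moreover have "x $ k = a $ k $ j / r" "x $ l = a $ l $ j / r"
      using eq [of k] eq [of l] kl \<open>0 < r\<close> by auto
    ultimately show ?thesis
      by (simp add: t_def add_divide_distrib)
  qed
  moreover have "x $ p = a $ p $ j / r" if "p \<noteq> i" for p
    using eq [OF that] \<open>0 < r\<close> by simp
  moreover have "1 - t = ?s / r"
    by (simp add: t_def)
  ultimately have "x $ q = (1 - t) * good_point a j $ q + (if q = i then t else 0)" for q
    using good_value_pos [of j] by (simp add: good_point_eq)
  then have "x = (1 - t) *\<^sub>R good_point a j + t *\<^sub>R axis i 1"
    unfolding vec_eq_iff closed_segment_axis_nth by blast
  with t show "x \<in> supporting_segment a j i"
    by (auto simp: supporting_segment_def in_segment)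
qed

lemma eq_good_point_iff:
  assumes x: "\<And>i. 0 < x $ i" "(\<Sum>i\<in>UNIV. x $ i) = 1"
  shows "x = good_point a j \<longleftrightarrow> (\<forall>p. best_for a x p j)"
proof
  assume "x = good_point a j"
  then have "a $ p $ j / x $ p = (\<Sum>k\<in>UNIV. a $ k $ j)" for p
    using valuation_pos [of p j] by (simp add: good_point_eq)
  then show "\<forall>p. best_for a x p j"
    by (simp add: best_for_def)
next
  assume best: "\<forall>p. best_for a x p j"
  have eq: "a $ p $ j = top_ratio a x j * x $ p" for p
    using best x(1) [of p] by (simp add: best_for_iff) (metis nonzero_divide_eq_eq less_irrefl)
  then have "(\<Sum>k\<in>UNIV. a $ k $ j) = top_ratio a x j"
    using x(2) by (simp flip: sum_distrib_left)
  moreover have "x $ p = a $ p $ j / top_ratio a x j" for p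
    using eq [of p] valuation_pos [of p j] by auto
  ultimately show "x = good_point a j"
    by (simp add: vec_eq_iff good_point_eq)
qed

lemma best_for_good_point:
  "best_for a (good_point a k) p j \<longleftrightarrow> (\<forall>q. a $ q $ j / a $ q $ k \<le> a $ p $ j / a $ p $ k)"
proof -
  have "best_for a (good_point a k) p j \<longleftrightarrow> best_for a (\<chi> i. a $ i $ k) p j"
    unfolding good_point_eq using good_value_pos by (intro best_for_scaleR) simp
  then show ?thesis
    by (simp add: best_for_def)
qed

text \<open>Dependent goods are exactly those whose points are collinear with a corner of the simplex.\<close>

lemma s_independent_iff:
  "s_independent a j k \<longleftrightarrow> (\<forall>p q. p \<noteq> q \<longrightarrow> a $ p $ j / a $ p $ k \<noteq> a $ q $ j / a $ q $ k)"
proof -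
  define \<rho> where "\<rho> p = a $ p $ j / a $ p $ k" for p
  have inv: "a $ p $ k / a $ p $ j = inverse (\<rho> p)" and pos: "0 < \<rho> p" for p
    by (simp_all add: \<rho>_def valuation_pos)
  have 1: "good_point a k \<in> supporting_segment a j i \<longleftrightarrow> (\<forall>p. p \<noteq> i \<longrightarrow> (\<forall>q. \<rho> q \<le> \<rho> p))" for i
    by (simp add: mem_supporting_segment_iff good_point_pos sum_good_point best_for_good_point \<rho>_def)
  have 2: "good_point a j \<in> supporting_segment a k i \<longleftrightarrow> (\<forall>p. p \<noteq> i \<longrightarrow> (\<forall>q. \<rho> p \<le> \<rho> q))" for i
    by (simp add: mem_supporting_segment_iff good_point_pos sum_good_point best_for_good_point inv pos)
  have "(\<exists>i. (\<forall>p. p \<noteq> i \<longrightarrow> (\<forall>q. \<rho> q \<le> \<rho> p)) \<or> (\<forall>p. p \<noteq> i \<longrightarrow> (\<forall>q. \<rho> p \<le> \<rho> q))) \<longleftrightarrow>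
      (\<exists>p q. p \<noteq> q \<and> \<rho> p = \<rho> q)" (is "?L \<longleftrightarrow> ?R")
  proof
    assume ?L
    then obtain i where i: "(\<forall>p. p \<noteq> i \<longrightarrow> (\<forall>q. \<rho> q \<le> \<rho> p)) \<or> (\<forall>p. p \<noteq> i \<longrightarrow> (\<forall>q. \<rho> p \<le> \<rho> q))" ..
    obtain k l where "i \<noteq> k" "i \<noteq> l" "k \<noteq> l"
      using other_players by blast
    with i have "\<rho> k = \<rho> l"
      by (metis order_antisym)
    with \<open>k \<noteq> l\<close> show ?R by blast
  next
    assume ?R
    then obtain p q where pq: "p \<noteq> q" "\<rho> p = \<rho> q" by blast
    then obtain r where r: "p \<noteq> r" "q \<noteq> r"
      using third_player by blast
    have all: "(\<forall>s. P s) \<longleftrightarrow> P p \<and> P q \<and> P r" for P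
      using UNIV_3_distinct [OF pq(1) r] by (metis UNIV_I insertE singletonD)
    \<comment> \<open>The third player \<open>r\<close> lies on one side of the common value, so
      \<open>p\<close> and \<open>q\<close> are jointly maximal or jointly minimal.\<close>
    show ?L
      using pq r by (intro exI [of _ r]) (auto simp: all)
  qed
  then show ?thesis
    unfolding s_independent_def 1 2 \<rho>_def [symmetric] by blast
qed

text \<open>By positivity of the values, a supporting segment minus its corner lies in the interior
  of the simplex, so \<open>RD\<close> is meaningful at every vertex.\<close>

lemma graph_vertex_pos:
  assumes "v \<in> graph_vertices a"
  shows "0 < v $ p" and "(\<Sum>i\<in>UNIV. v $ i) = 1"
proof -
  show "(\<Sum>i\<in>UNIV. v $ i) = 1"
    using assms by (simp add: graph_vertices_def RNS_def)
  have "(\<exists>j. v = good_point a j) \<or> (\<exists>j i. v \<in> supporting_segment a j i \<and> (\<forall>p. v \<noteq> axis p 1))"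
    using assms by (auto simp: graph_vertices_def)
  then show "0 < v $ p"
  proof (elim disjE exE conjE)
    fix j i
    assume "v \<in> supporting_segment a j i" and not_axis: "\<forall>p. v \<noteq> axis p 1"
    then obtain t where t: "0 \<le> t" "t \<le> 1" "v = (1 - t) *\<^sub>R good_point a j + t *\<^sub>R axis i 1"
      by (auto simp: supporting_segment_def in_segment)
    moreover have "t \<noteq> 1"
      using t(3) not_axis by auto
    ultimately have "0 < (1 - t) * good_point a j $ p"
      by (simp add: good_point_pos)
    then show ?thesis
      using t(1) unfolding t(3) closed_segment_axis_nth by auto
  qed (simp add: good_point_pos)
qed

text \<open>This removes s-independence from the description: if segments of two goods to distinct
  corners meet at \<open>x\<close>, then the goods are s-independent or one of them is plotted at
  \<open>x\<close>.\<close>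

lemma graph_vertices_iff:
  assumes x: "\<And>i. 0 < x $ i" "(\<Sum>i\<in>UNIV. x $ i) = 1"
  shows "x \<in> graph_vertices a \<longleftrightarrow> (\<exists>i l. i \<noteq> l \<and> tied_away a x i \<and> tied_away a x l)"
proof
  assume "x \<in> graph_vertices a"
  then consider j where "x = good_point a j"
    | j k i l where "s_independent a j k" "x \<in> supporting_segment a j i" "x \<in> supporting_segment a k l"
    by (auto simp: graph_vertices_def)
  then show "\<exists>i l. i \<noteq> l \<and> tied_away a x i \<and> tied_away a x l"
  proof cases
    case 1
    then have "tied_away a x i" for i
      using eq_good_point_iff [OF x] by (auto simp: tied_away_def)
    then show ?thesis
      using other_players [of 1] by metis
  next
    case 2
    then have best: "\<forall>p. p \<noteq> i \<longrightarrow> best_for a x p j" "\<forall>p. p \<noteq> l \<longrightarrow> best_for a x p k"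
      by (simp_all add: mem_supporting_segment_iff x)
    \<comment> \<open>With a common corner, both goods would have values proportional to
      \<open>x\<close> off that corner, so two ratios would agree, against s-independence.\<close>
    have "i \<noteq> l"
    proof
      assume "i = l"
      obtain p q where pq: "i \<noteq> p" "i \<noteq> q" "p \<noteq> q"
        using other_players by blast
      have j: "a $ r $ j = top_ratio a x j * x $ r" and k: "a $ r $ k = top_ratio a x k * x $ r"
        if "r \<noteq> i" for r
        using that best \<open>i = l\<close> x(1) [of r] by (auto simp: best_for_iff field_simps)
      have "a $ r $ j / a $ r $ k = top_ratio a x j / top_ratio a x k" if "r \<noteq> i" for r
        using j [OF that] k [OF that] x(1) [of r] by simp
      then show False
        using pq 2(1) unfolding s_independent_iff by metis
    qed
    then show ?thesis
      using best unfolding tied_away_def by blast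
  qed
next
  assume "\<exists>i l. i \<noteq> l \<and> tied_away a x i \<and> tied_away a x l"
  then obtain i l j k where "i \<noteq> l" and
    best: "\<And>p. p \<noteq> i \<Longrightarrow> best_for a x p j" "\<And>p. p \<noteq> l \<Longrightarrow> best_for a x p k"
    unfolding tied_away_def by blast
  obtain m where m: "i \<noteq> m" "l \<noteq> m"
    using third_player [OF \<open>i \<noteq> l\<close>] .
  have UNIV: "s = i \<or> s = l \<or> s = m" for s
    using UNIV_3_distinct [OF \<open>i \<noteq> l\<close> m] by blast
  then have all: "(\<forall>s. P s) \<longleftrightarrow> P i \<and> P l \<and> P m" for P
    by metis
  have RNS: "x \<in> RNS"
    using x by (simp add: RNS_def less_imp_le)
  show "x \<in> graph_vertices a"
  proof (cases "s_independent a j k")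
    case True
    have "x \<noteq> axis p 1" for p
    proof -
      obtain q where "q \<noteq> p"
        using other_players [of p] by metis
      then show ?thesis
        using x(1) [of q] by (auto simp: axis_def)
    qed
    moreover have "x \<in> supporting_segment a j i" "x \<in> supporting_segment a k l"
      using best by (auto simp: mem_supporting_segment_iff x)
    ultimately show ?thesis
      using True RNS unfolding graph_vertices_def by blast
  next
    case False
    define \<beta> where "\<beta> p = a $ p $ j / x $ p" for p
    define \<beta>' where "\<beta>' p = a $ p $ k / x $ p" for p
    have pos: "0 < \<beta> p" "0 < \<beta>' p" for p
      by (simp_all add: \<beta>_def \<beta>'_def valuation_pos x)
    have ratio: "a $ p $ j / a $ p $ k = \<beta> p / \<beta>' p" for p
      using x(1) [of p] by (simp add: \<beta>_def \<beta>'_def)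
    have \<beta>: "\<beta> l = \<beta> m" "\<beta> i \<le> \<beta> m" and \<beta>': "\<beta>' i = \<beta>' m" "\<beta>' l \<le> \<beta>' m"
      using best \<open>i \<noteq> l\<close> m by (auto simp: best_for_def \<beta>_def \<beta>'_def intro: order_antisym)
    define \<rho> where "\<rho> p = \<beta> p / \<beta>' p" for p
    have le: "\<rho> i \<le> \<rho> m" "\<rho> m \<le> \<rho> l"
      using \<beta> \<beta>' pos by (simp_all add: \<rho>_def divide_right_mono divide_left_mono less_imp_le)
    obtain p q where "p \<noteq> q" "\<rho> p = \<rho> q"
      using False unfolding s_independent_iff ratio \<rho>_def by blast
    \<comment> \<open>Player \<open>m\<close> is best for both goods, so \<open>\<rho> m\<close>
      lies between \<open>\<rho> i\<close> and \<open>\<rho> l\<close>; any coincidence therefore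
      involves \<open>\<rho> m\<close>, and it makes one of the goods tied among all three
      players.\<close>
    then have "\<rho> i = \<rho> m \<or> \<rho> m = \<rho> l"
      using UNIV [of p] UNIV [of q] le by (elim disjE) auto
    then have "\<beta> i / \<beta>' i = \<beta> m / \<beta>' m \<or> \<beta> m / \<beta>' m = \<beta> l / \<beta>' l"
      by (simp add: \<rho>_def)
    then have "\<beta> i = \<beta> m \<or> \<beta>' m = \<beta>' l"
      using \<beta> \<beta>' pos(1) [of m] pos(2) [of m] pos(2) [of l] by (auto simp: field_simps)
    then have "(\<forall>p q. \<beta> p \<le> \<beta> q) \<or> (\<forall>p q. \<beta>' p \<le> \<beta>' q)"
      using \<beta>(1) \<beta>'(1) by (auto simp: all)
    then have "(\<forall>p. best_for a x p j) \<or> (\<forall>p. best_for a x p k)"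
      unfolding best_for_def \<beta>_def \<beta>'_def by blast
    then show ?thesis
      using RNS eq_good_point_iff [OF x] unfolding graph_vertices_def by blast
  qed
qed

text \<open>
  Along a supporting segment towards player \<open>i\<close>, a vertex occurs exactly where \<open>i\<close> ties with
  another player over some good, so the first such stop is an adjacent vertex.
\<close>

lemma graph_adjacent_shift:
  assumes v: "v \<in> graph_vertices a"
    and s: "0 < s" "s \<noteq> 1"
    and seg: "\<And>p. p \<noteq> i \<Longrightarrow> best_for a v p j" "\<And>p. p \<noteq> i \<Longrightarrow> best_for a (shift v i s) p j"
    and stop: "q \<noteq> i" "best_for a (shift v i s) i j'" "best_for a (shift v i s) q j'"
    and no_stop: "\<And>t j' q. \<lbrakk>min 1 s < t; t < max 1 s; q \<noteq> i; best_for a (shift v i t) i j'\<rbrakk>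
      \<Longrightarrow> \<not> best_for a (shift v i t) q j'"
  shows "graph_adjacent a v (normalize_vec (shift v i s))"
proof -
  let ?y = "shift v i s"
  define w where "w = normalize_vec ?y"
  define c where "c = 1 / (\<Sum>p\<in>UNIV. ?y $ p)"
  have vpos: "0 < v $ p" and vsum: "(\<Sum>p\<in>UNIV. v $ p) = 1" for p
    using graph_vertex_pos [OF v] by auto
  have ypos: "0 < ?y $ p" for p
    using vpos s by (intro shift_pos) auto
  have w_eq: "w = c *\<^sub>R ?y" and c: "0 < c"
    using sum_pos_vec [of ?y] ypos by (simp_all add: w_def c_def normalize_vec_scaleR)
  have w_nth: "w $ p = (if p = i then c * v $ i / s else c * v $ p)" for p
    by (simp add: w_eq shift_nth)
  have wpos: "0 < w $ p" and wsum: "(\<Sum>p\<in>UNIV. w $ p) = 1" for p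
    unfolding w_def by (auto intro: normalize_vec_pos sum_normalize_vec ypos)
  have best_w: "best_for a w p k \<longleftrightarrow> best_for a ?y p k" for p k
    unfolding w_eq by (rule best_for_scaleR [OF c])
  obtain l where l: "i \<noteq> l" "q \<noteq> l"
    using third_player [of i q] stop(1) by metis
  have UNIV: "p = i \<or> p = q \<or> p = l" for p
    using UNIV_3_distinct [of i q l] stop(1) l by blast
  \<comment> \<open>Good \<open>j\<close> keeps \<open>w\<close> on the segment towards
    \<open>i\<close>; the tie of \<open>i\<close> and \<open>q\<close> over \<open>j'\<close> puts
    it on a second one, towards \<open>l\<close>.\<close>
  have "tied_away a w i"
    unfolding tied_away_def best_w using seg(2) by blast
  moreover have "tied_away a w l"
    unfolding tied_away_def best_w using stop UNIV by metis
  ultimately have "w \<in> graph_vertices a"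
    using graph_vertices_iff [OF wpos wsum] l(1) by blast
  moreover have "v \<noteq> w"
  proof
    assume "v = w"
    then have "c = 1"
      using w_nth [of q] stop(1) vpos [of q] by simp
    then show False
      using w_nth [of i] \<open>v = w\<close> vpos [of i] s by (simp add: field_simps)
  qed
  moreover have "v \<in> supporting_segment a j i" "w \<in> supporting_segment a j i"
    using seg by (simp_all add: mem_supporting_segment_iff vpos vsum wpos wsum best_w)
  moreover have "u \<notin> graph_vertices a" if "u \<in> open_segment v w" for u
  proof
    assume "u \<in> graph_vertices a"
    obtain z where z: "0 < z" "z < 1" "u = (1 - z) *\<^sub>R v + z *\<^sub>R w"
      using \<open>u \<in> open_segment v w\<close> by (auto simp: in_segment)
    \<comment> \<open>Between \<open>v\<close> and \<open>w\<close> the coordinate of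
      \<open>i\<close> is multiplied by \<open>e\<close> and the others by \<open>d\<close>. Up to
      scaling this is again a shift, with parameter \<open>d / e\<close> strictly between 1 and
      \<open>s\<close>.\<close>
    define d where "d = (1 - z) + z * c"
    define e where "e = (1 - z) + z * c / s"
    define t where "t = d / e"
    have d: "0 < d"
      unfolding d_def using z c by (intro add_pos_pos) auto
    have e: "0 < e"
      unfolding e_def using z c s by (intro add_pos_pos) auto
    have "u $ p = (if p = i then v $ i * e else v $ p * d)" for p
      by (simp add: z(3) w_nth d_def e_def algebra_simps)
    then have u_eq: "u = d *\<^sub>R shift v i t"
      using d e by (simp add: vec_eq_iff shift_nth t_def)
    have best_u: "best_for a u p k \<longleftrightarrow> best_for a (shift v i t) p k" for p k
      unfolding u_eq by (rule best_for_scaleR [OF d])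
    have between: "min 1 s < t \<and> t < max 1 s"
    proof -
      have "t < 1 \<longleftrightarrow> d < e" "1 < t \<longleftrightarrow> e < d" "s < t \<longleftrightarrow> s * e < d" "t < s \<longleftrightarrow> d < s * e"
        using e by (simp_all add: t_def field_simps)
      moreover have "d - e = z * c * (s - 1) / s" "s * e - d = (1 - z) * (s - 1)"
        using s by (simp_all add: d_def e_def field_simps)
      moreover have "0 < z * c * (s - 1) / s \<longleftrightarrow> 1 < s" "z * c * (s - 1) / s < 0 \<longleftrightarrow> s < 1"
          "0 < (1 - z) * (s - 1) \<longleftrightarrow> 1 < s" "(1 - z) * (s - 1) < 0 \<longleftrightarrow> s < 1"
        using z c s by (auto simp: zero_less_mult_iff zero_less_divide_iff mult_less_0_iff divide_less_0_iff)
      ultimately show ?thesis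
        using s(2) by (cases "s < 1") auto
    qed
    \<comment> \<open>A vertex is tied away from two corners, hence from some \<open>l'\<close>
      other than \<open>i\<close>; this makes \<open>i\<close> tie with the third player, which
      \<open>no_stop\<close> forbids.\<close>
    obtain l' where "l' \<noteq> i" "tied_away a u l'"
      using graph_vertices_iff [of u] \<open>u \<in> graph_vertices a\<close> graph_vertex_pos [of u] by metis
    then obtain k where k: "\<And>p. p \<noteq> l' \<Longrightarrow> best_for a u p k"
      unfolding tied_away_def by blast
    obtain r where "i \<noteq> r" "l' \<noteq> r"
      using third_player [of i l'] \<open>l' \<noteq> i\<close> by metis
    then show False
      using no_stop [of t r k] between k [of r] k [of i] \<open>l' \<noteq> i\<close> unfolding best_u by auto
  qed
  ultimately show ?thesis
    using v unfolding graph_adjacent_def w_def by blast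
qed

section \<open>Local minimality along the line through one corner\<close>

context
  fixes v :: "real ^ 3" and i k l :: 3
  assumes v: "v \<in> graph_vertices a"
    and local_min: "\<And>w. graph_adjacent a v w \<Longrightarrow> g_tilde a v \<le> g_tilde a w"
    and ikl: "i \<noteq> k" "i \<noteq> l" "k \<noteq> l"
begin

text \<open>Along the line through corner \<open>i\<close>, good \<open>j\<close> enters only
  through \<open>n j\<close> and \<open>m j\<close>: its top ratio is
  \<open>max (s * n j) (m j)\<close>, with a breakpoint at \<open>s = m j / n j\<close>.\<close>

private definition n :: "'m \<Rightarrow> real" where "n j = a $ i $ j / v $ i"

private definition m :: "'m \<Rightarrow> real" where "m j = max (a $ k $ j / v $ k) (a $ l $ j / v $ l)"

private lemma n_pos: "0 < n j"
  by (simp add: n_def valuation_pos graph_vertex_pos [OF v])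

private lemma UNIV_eq: "UNIV = {i, k, l}"
  by (rule UNIV_3_distinct [OF ikl])

private lemma all_players: "(\<forall>p. P p) \<longleftrightarrow> P i \<and> P k \<and> P l"
  using UNIV_eq by (metis UNIV_I insertE singletonD)

private lemma top_ratio_shift: "top_ratio a (shift v i s) j = max (s * n j) (m j)"
  using ikl by (simp add: top_ratio_def UNIV_eq shift_nth n_def m_def mult.commute max.assoc)

private lemma shift_1: "shift v i 1 = v"
  by (simp add: shift_def vec_eq_iff)

private lemma top_ratio_eq: "top_ratio a v j = max (n j) (m j)"
  using top_ratio_shift [of 1 j] by (simp add: shift_1)

private lemma best_for_shift:
  "best_for a (shift v i s) i j \<longleftrightarrow> m j \<le> s * n j"
  "best_for a (shift v i s) k j \<longleftrightarrow> a $ k $ j / v $ k = max (s * n j) (m j)"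
  "best_for a (shift v i s) l j \<longleftrightarrow> a $ l $ j / v $ l = max (s * n j) (m j)"
  using ikl by (auto simp: best_for_iff top_ratio_shift shift_nth n_def mult.commute)

private lemma best_for_v:
  "best_for a v i j \<longleftrightarrow> m j \<le> n j"
  "best_for a v k j \<longleftrightarrow> a $ k $ j / v $ k = max (n j) (m j)"
  "best_for a v l j \<longleftrightarrow> a $ l $ j / v $ l = max (n j) (m j)"
  using best_for_shift [of 1 j] by (simp_all add: shift_1)

private lemma best_for_others: "best_for a v k j \<or> best_for a v l j \<longleftrightarrow> n j \<le> m j"
  unfolding best_for_v by (auto simp: m_def)

private lemma total: "g_tilde a v * (1 / v $ i + 1 / v $ k + 1 / v $ l) = (\<Sum>j\<in>UNIV. max (n j) (m j))"
proof -
  have "0 < 1 / v $ i + 1 / v $ k + 1 / v $ l"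
    using graph_vertex_pos(1) [OF v] by (intro add_pos_pos) auto
  moreover have "(\<Sum>p\<in>UNIV. 1 / v $ p) = 1 / v $ i + 1 / v $ k + 1 / v $ l"
    using ikl by (simp add: UNIV_eq)
  ultimately show ?thesis
    using g_tilde_eq [of v a] graph_vertex_pos(1) [OF v] by (simp add: top_ratio_eq)
qed

text \<open>Local minimality applied to the neighbour at the first breakpoint \<open>s\<close>, with
  denominators cleared. The good in \<open>tie\<close> supplies the segment, the one in
  \<open>stop\<close> the vertex, and \<open>no_stop\<close> the adjacency.\<close>

private lemma walk_value:
  assumes s: "0 < s" "s \<noteq> 1"
    and tie: "a $ k $ j / v $ k = a $ l $ j / v $ l" "n j \<le> m j" "s * n j \<le> m j"
    and stop: "s * n j' = m j'"
    and no_stop: "\<And>t j. \<lbrakk>min 1 s < t; t < max 1 s\<rbrakk> \<Longrightarrow> t * n j \<noteq> m j"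
  shows "g_tilde a v * (s / v $ i + 1 / v $ k + 1 / v $ l) \<le> (\<Sum>j\<in>UNIV. max (s * n j) (m j))"
proof -
  let ?y = "shift v i s"
  have ypos: "0 < ?y $ p" for p
    using graph_vertex_pos(1) [OF v] s by (intro shift_pos) auto
  have "\<exists>q. q \<noteq> i \<and> best_for a ?y q j'"
  proof (cases "a $ k $ j' / v $ k = m j'")
    case True
    then have "best_for a ?y k j'"
      using stop by (simp add: best_for_shift)
    then show ?thesis
      using ikl by metis
  next
    case False
    then have "best_for a ?y l j'"
      using stop by (auto simp: best_for_shift m_def max_def split: if_splits)
    then show ?thesis
      using ikl by metis
  qed
  then obtain q where q: "q \<noteq> i" "best_for a ?y q j'"
    by blast
  have v_tie: "\<forall>p. p \<noteq> i \<longrightarrow> best_for a v p j"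
    using tie by (auto simp: all_players best_for_v m_def)
  have y_tie: "\<forall>p. p \<noteq> i \<longrightarrow> best_for a ?y p j"
    using tie by (auto simp: all_players best_for_shift m_def)
  have no_tie: "\<not> best_for a (shift v i t) r h"
    if "min 1 s < t" "t < max 1 s" "r \<noteq> i" "best_for a (shift v i t) i h" for t h r
  proof
    assume "best_for a (shift v i t) r h"
    then have "best_for a (shift v i t) k h \<or> best_for a (shift v i t) l h"
      using that(3) UNIV_eq by (metis UNIV_I insertE singletonD)
    then have "t * n h \<le> m h"
      unfolding best_for_shift by (auto simp: m_def)
    then show False
      using no_stop [OF that(1,2), of h] that(4) by (simp add: best_for_shift)
  qed
  have "graph_adjacent a v (normalize_vec ?y)"
  proof (rule graph_adjacent_shift)
    show "best_for a ?y i j'"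
      using stop by (simp add: best_for_shift)
  qed (use v s q v_tie y_tie no_tie in auto)
  then have "g_tilde a v \<le> g_tilde a (normalize_vec ?y)"
    by (rule local_min)
  also have "\<dots> = g_tilde a ?y"
    unfolding normalize_vec_scaleR using sum_pos_vec [of ?y] ypos by (intro g_tilde_scaleR) auto
  also have "\<dots> = (\<Sum>j\<in>UNIV. max (s * n j) (m j)) / (s / v $ i + 1 / v $ k + 1 / v $ l)"
    unfolding g_tilde_eq [OF ypos] top_ratio_shift
    using ikl by (auto simp: UNIV_eq shift_nth add.assoc)
  finally show ?thesis
    using s graph_vertex_pos(1) [OF v] by (simp add: pos_le_divide_eq add_pos_pos)
qed

text \<open>Move towards corner \<open>i\<close>, so \<open>s < 1\<close>. Up to the first
  breakpoint the sum of top ratios is \<open>P + s * Q\<close>; subtracting \<open>s\<close> times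
  the identity at \<open>s = 1\<close> leaves the claim times \<open>1 - s\<close>. If no good
  strictly favours \<open>i\<close>, no breakpoint occurs, but then \<open>P\<close> is the whole
  total.\<close>

lemma pair_demand:
  assumes "tied_away a v i"
  shows "g_tilde a v * (1 / v $ k + 1 / v $ l)
    \<le> (\<Sum>j | best_for a v k j \<or> best_for a v l j. top_ratio a v j)"
proof -
  obtain j where j: "best_for a v k j" "best_for a v l j"
    using assms ikl unfolding tied_away_def by metis
  define S where "S = {j. m j < n j}"
  define P where "P = (\<Sum>j\<in>-S. m j)"
  define Q where "Q = (\<Sum>j\<in>S. n j)"
  have split: "(\<Sum>j\<in>UNIV. f j) = (\<Sum>j\<in>-S. f j) + (\<Sum>j\<in>S. f j)" for f :: "'m \<Rightarrow> real"
    by (metis Compl_partition2 Compl_disjoint2 finite sum.union_disjoint)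
  have PQ: "g_tilde a v * (1 / v $ i + 1 / v $ k + 1 / v $ l) = P + Q"
    unfolding total split P_def Q_def
    by (intro arg_cong2 [where f = "(+)"] sum.cong) (auto simp: S_def)
  define \<alpha> where "\<alpha> = g_tilde a v * (1 / v $ i)"
  define \<beta> where "\<beta> = g_tilde a v * (1 / v $ k + 1 / v $ l)"
  have PQ': "\<alpha> + \<beta> = P + Q"
    unfolding PQ [symmetric] by (simp add: \<alpha>_def \<beta>_def distrib_left)
  have g: "0 \<le> g_tilde a v"
    by (intro g_tilde_nonneg graph_vertex_pos(1) [OF v])
  have "g_tilde a v * (1 / v $ k + 1 / v $ l) \<le> P"
  proof (cases "S = {}")
    case True
    then have "P = g_tilde a v * (1 / v $ k + 1 / v $ l) + g_tilde a v / v $ i"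
      using PQ by (simp add: Q_def algebra_simps)
    then show ?thesis
      using g graph_vertex_pos(1) [OF v, of i] by simp
  next
    case False
    \<comment> \<open>The breakpoint below 1 that is met first when \<open>s\<close>
      decreases.\<close>
    define s where "s = Max ((\<lambda>j. m j / n j) ` S)"
    have "s \<in> (\<lambda>j. m j / n j) ` S"
      unfolding s_def using False by (intro Max_in) auto
    then obtain j' where j': "j' \<in> S" "s = m j' / n j'"
      by blast
    have ge: "m h / n h \<le> s" if "h \<in> S" for h
      unfolding s_def using that by (intro Max_ge) auto
    have m_pos: "0 < m h" for h
      using valuation_pos [of k h] graph_vertex_pos(1) [OF v, of k] by (simp add: m_def less_max_iff_disj)
    have s: "0 < s" "s < 1"
      using j' n_pos [of j'] m_pos [of j'] by (auto simp: S_def)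
    have "g_tilde a v * (s / v $ i + 1 / v $ k + 1 / v $ l) \<le> (\<Sum>j\<in>UNIV. max (s * n j) (m j))"
    proof (rule walk_value)
      show "n j \<le> m j"
        using j best_for_others by blast
      then show "s * n j \<le> m j"
        using s n_pos [of j] by (smt (verit) mult_left_le_one_le)
      show "s * n j' = m j'"
        using j' n_pos [of j'] by simp
      show "t * n h \<noteq> m h" if "min 1 s < t" "t < max 1 s" for t h
      proof
        assume "t * n h = m h"
        moreover have "s * n h < t * n h" "t * n h < 1 * n h"
          using that s n_pos [of h] by (intro mult_strict_right_mono; simp)+
        ultimately show False
          using ge [of h] n_pos [of h] by (simp add: S_def field_simps)
      qed
    qed (use j s best_for_v in auto)
    also have "\<dots> = P + s * Q"
      unfolding split P_def Q_def sum_distrib_left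
    proof (intro arg_cong2 [where f = "(+)"] sum.cong refl)
      show "max (s * n h) (m h) = m h" if "h \<in> - S" for h
      proof -
        have "s * n h \<le> 1 * n h"
          using s n_pos [of h] by (intro mult_right_mono) auto
        then show ?thesis
          using that by (simp add: S_def max_def)
      qed
      show "max (s * n h) (m h) = s * n h" if "h \<in> S" for h
        using ge [OF that] n_pos [of h] by (simp add: max_def field_simps)
    qed
    finally have walk: "s * \<alpha> + \<beta> \<le> P + s * Q"
      by (simp add: \<alpha>_def \<beta>_def distrib_left mult.commute)
    have "s * \<alpha> + s * \<beta> = s * P + s * Q"
      using PQ' by (simp flip: distrib_left)
    with walk have "(1 - s) * \<beta> \<le> (1 - s) * P"
      by (simp add: left_diff_distrib)
    then show ?thesis
      using s unfolding \<beta>_def [symmetric] by simp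
  qed
  also have "P = (\<Sum>j | best_for a v k j \<or> best_for a v l j. top_ratio a v j)"
    unfolding P_def best_for_others by (intro sum.cong) (auto simp: S_def top_ratio_eq)
  finally show ?thesis .
qed

text \<open>Now move away from corner \<open>i\<close>, so \<open>s > 1\<close>. As \<open>i\<close>
  is not best for \<open>j\<close>, the segment of \<open>j\<close> continues beyond
  \<open>v\<close> in this direction, and a breakpoint comes at the latest at the point of
  \<open>j\<close>.\<close>

lemma single_demand:
  assumes j: "best_for a v k j" "best_for a v l j" "\<not> best_for a v i j"
  shows "g_tilde a v * (1 / v $ i) \<le> (\<Sum>j | best_for a v i j. top_ratio a v j)"
proof -
  define S where "S = {j. n j < m j}"
  define P where "P = (\<Sum>j\<in>-S. n j)"
  define Q where "Q = (\<Sum>j\<in>S. m j)"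
  have split: "(\<Sum>j\<in>UNIV. f j) = (\<Sum>j\<in>-S. f j) + (\<Sum>j\<in>S. f j)" for f :: "'m \<Rightarrow> real"
    by (metis Compl_partition2 Compl_disjoint2 finite sum.union_disjoint)
  have PQ: "g_tilde a v * (1 / v $ i + 1 / v $ k + 1 / v $ l) = P + Q"
    unfolding total split P_def Q_def
    by (intro arg_cong2 [where f = "(+)"] sum.cong) (auto simp: S_def)
  define \<alpha> where "\<alpha> = g_tilde a v * (1 / v $ i)"
  define \<beta> where "\<beta> = g_tilde a v * (1 / v $ k + 1 / v $ l)"
  have PQ': "\<alpha> + \<beta> = P + Q"
    unfolding PQ [symmetric] by (simp add: \<alpha>_def \<beta>_def distrib_left)
  \<comment> \<open>The first breakpoint above 1; \<open>j\<close> itself belongs to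
    \<open>S\<close>, so the minimum is over a nonempty set.\<close>
  define s where "s = Min ((\<lambda>j. m j / n j) ` S)"
  have "j \<in> S"
    using j(3) by (simp add: S_def best_for_v)
  then have "s \<in> (\<lambda>j. m j / n j) ` S"
    unfolding s_def by (intro Min_in) auto
  then obtain j' where j': "j' \<in> S" "s = m j' / n j'"
    by blast
  have le: "s \<le> m h / n h" if "h \<in> S" for h
    unfolding s_def using that by (intro Min_le) auto
  have s: "1 < s"
    using j' n_pos [of j'] by (auto simp: S_def)
  have "g_tilde a v * (s / v $ i + 1 / v $ k + 1 / v $ l) \<le> (\<Sum>j\<in>UNIV. max (s * n j) (m j))"
  proof (rule walk_value)
    show "n j \<le> m j"
      using \<open>j \<in> S\<close> by (simp add: S_def)
    show "s * n j \<le> m j"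
      using le [OF \<open>j \<in> S\<close>] n_pos [of j] by (simp add: field_simps)
    show "s * n j' = m j'"
      using j' n_pos [of j'] by simp
    show "t * n h \<noteq> m h" if "min 1 s < t" "t < max 1 s" for t h
    proof
      assume "t * n h = m h"
      moreover have "1 * n h < t * n h" "t * n h < s * n h"
        using that s n_pos [of h] by (intro mult_strict_right_mono; simp)+
      ultimately show False
        using le [of h] n_pos [of h] by (simp add: S_def field_simps)
    qed
  qed (use j s best_for_v in auto)
  also have "\<dots> = s * P + Q"
    unfolding split P_def Q_def sum_distrib_left
  proof (intro arg_cong2 [where f = "(+)"] sum.cong refl)
    show "max (s * n h) (m h) = s * n h" if "h \<in> - S" for h
    proof -
      have "1 * n h \<le> s * n h"
        using s n_pos [of h] by (intro mult_right_mono) auto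
      then show ?thesis
        using that by (simp add: S_def max_def)
    qed
    show "max (s * n h) (m h) = m h" if "h \<in> S" for h
      using le [OF that] n_pos [of h] by (simp add: max_def field_simps)
  qed
  finally have walk: "s * \<alpha> + \<beta> \<le> s * P + Q"
    by (simp add: \<alpha>_def \<beta>_def distrib_left mult.commute)
  with PQ' have "(s - 1) * \<alpha> \<le> (s - 1) * P"
    by (simp add: left_diff_distrib)
  then have "g_tilde a v * (1 / v $ i) \<le> P"
    using s unfolding \<alpha>_def [symmetric] by simp
  also have "P = (\<Sum>j | best_for a v i j. top_ratio a v j)"
    unfolding P_def best_for_v by (intro sum.cong) (auto simp: S_def top_ratio_eq)
  finally show ?thesis .
qed

end

section \<open>The Hall-type inequalities and the egalitarian point\<close>

lemma graph_vertex_demand: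
  assumes v: "v \<in> graph_vertices a"
    and local_min: "\<And>w. graph_adjacent a v w \<Longrightarrow> g_tilde a v \<le> g_tilde a w"
    and ikl: "i \<noteq> k" "i \<noteq> l" "k \<noteq> l"
  shows "g_tilde a v * (1 / v $ k + 1 / v $ l)
      \<le> (\<Sum>j | best_for a v k j \<or> best_for a v l j. top_ratio a v j)" (is ?pair)
    and "g_tilde a v * (1 / v $ i) \<le> (\<Sum>j | best_for a v i j. top_ratio a v j)" (is ?single)
proof -
  define T where "T X = (\<Sum>j | X j. top_ratio a v j)" for X
  have T_eq: "T X = (\<Sum>j\<in>UNIV. if X j then top_ratio a v j else 0)" for X
    by (simp add: T_def sum.If_cases)
  have top_pos: "0 < top_ratio a v j" for j
    by (intro top_ratio_pos graph_vertex_pos(1) [OF v])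
  have single: "g_tilde a v * (1 / v $ p) \<le> T (best_for a v p)"
    if "p \<noteq> q" "p \<noteq> r" "q \<noteq> r" "best_for a v q j" "best_for a v r j" "\<not> best_for a v p j" for p q r j
    unfolding T_def using single_demand [OF v local_min that] .
  have pair: "g_tilde a v * (1 / v $ q + 1 / v $ r) \<le> T (\<lambda>j. best_for a v q j \<or> best_for a v r j)"
    if pqr: "p \<noteq> q" "p \<noteq> r" "q \<noteq> r" for p q r
  proof (cases "tied_away a v p")
    case True
    then show ?thesis
      unfolding T_def using pair_demand [OF v local_min pqr] by blast
  next
    case False
    have UNIV: "s = p \<or> s = q \<or> s = r" for s
      using UNIV_3_distinct [OF pqr] by blast
    \<comment> \<open>A vertex lies on segments to two corners, so these are \<open>q\<close> and
      \<open>r\<close>. No good has both \<open>q\<close> and \<open>r\<close> as best players, so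
      the single demands of \<open>q\<close> and \<open>r\<close> simply add up.\<close>
    have "tied_away a v q" "tied_away a v r"
      using False UNIV v graph_vertices_iff [OF graph_vertex_pos [OF v]] by metis+
    then obtain j j' where j: "best_for a v p j" "best_for a v r j"
      and j': "best_for a v p j'" "best_for a v q j'"
      using pqr unfolding tied_away_def by metis
    have excl: "\<not> (best_for a v q h \<and> best_for a v r h)" for h
      using False UNIV unfolding tied_away_def by metis
    have "g_tilde a v * (1 / v $ q) \<le> T (best_for a v q)"
      using single [of q p r j] pqr j excl by metis
    moreover have "g_tilde a v * (1 / v $ r) \<le> T (best_for a v r)"
      using single [of r p q j'] pqr j' excl by metis
    moreover have "T (\<lambda>j. best_for a v q j \<or> best_for a v r j) = T (best_for a v q) + T (best_for a v r)"
      unfolding T_eq sum.distrib [symmetric] using excl by (intro sum.cong) auto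
    ultimately show ?thesis
      by (simp add: distrib_left)
  qed
  show ?pair
    using pair [OF ikl] by (simp add: T_def)
  have "g_tilde a v * (1 / v $ i) \<le> T (best_for a v i)"
  proof (cases "\<exists>j. best_for a v k j \<and> best_for a v l j \<and> \<not> best_for a v i j")
    case True
    then show ?thesis
      using single ikl by blast
  next
    case False
    have UNIV: "UNIV = {i, k, l}"
      by (rule UNIV_3_distinct [OF ikl])
    have ex: "best_for a v i j \<or> best_for a v k j \<or> best_for a v l j" for j
      using ex_best_for [of a v j] UNIV by (metis UNIV_I insertE singletonD)
    \<comment> \<open>Modularity: without goods tied between \<open>k\<close> and \<open>l\<close>
      only, the demands of the pairs containing \<open>i\<close>, minus the total, give the single
      demand of \<open>i\<close>.\<close>
    have "T (\<lambda>j. best_for a v i j \<or> best_for a v k j) + T (\<lambda>j. best_for a v i j \<or> best_for a v l j)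
        \<le> T (best_for a v i) + T (\<lambda>_. True)"
      unfolding T_eq sum.distrib [symmetric] using ex False top_pos
      by (intro sum_mono) (auto simp: less_imp_le)
    moreover have "T (\<lambda>_. True) = g_tilde a v * (1 / v $ i + 1 / v $ k + 1 / v $ l)"
    proof -
      have "(\<Sum>p\<in>UNIV. 1 / v $ p) = 1 / v $ i + 1 / v $ k + 1 / v $ l"
        using ikl by (simp add: UNIV)
      moreover have "(\<Sum>p\<in>UNIV. 1 / v $ p) > 0"
        using graph_vertex_pos(1) [OF v] by (intro sum_pos) auto
      ultimately show ?thesis
        using g_tilde_eq [of v a] graph_vertex_pos(1) [OF v] by (simp add: T_def)
    qed
    ultimately show ?thesis
      using pair [of l i k] pair [of k i l] ikl by (simp add: distrib_left)
  qed
  then show ?single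
    by (simp add: T_def)
qed

text \<open>Hall's criterion by duality: a hyperplane separating the point from the face is
  contradicted by the greedy allocation for its normal vector \<open>d\<close>.\<close>

lemma egalitarian_if_demand:
  assumes v: "\<And>p. 0 < v $ p"
    and single: "\<And>i. g_tilde a v * (1 / v $ i) \<le> (\<Sum>j | best_for a v i j. top_ratio a v j)"
    and pair: "\<And>k l. k \<noteq> l \<Longrightarrow> g_tilde a v * (1 / v $ k + 1 / v $ l)
      \<le> (\<Sum>j | best_for a v k j \<or> best_for a v l j. top_ratio a v j)"
  shows "g_tilde a v *\<^sub>R (\<chi> i. 1) \<in> pareto_face a v"
proof (rule ccontr)
  let ?G = "g_tilde a v"
  assume "?G *\<^sub>R (\<chi> i. 1) \<notin> pareto_face a v"
  then obtain d b where d: "d \<bullet> (?G *\<^sub>R (\<chi> i. 1)) < b" "\<And>y. y \<in> pareto_face a v \<Longrightarrow> b < d \<bullet> y"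
    using separating_hyperplane_closed_point [OF convex_pareto_face closed_pareto_face] by blast
  \<comment> \<open>A best player \<open>p\<close> gains \<open>top_ratio a v j * v $ p\<close> from
    good \<open>j\<close>, so \<open>\<delta> p\<close> is the decrease of \<open>d\<close> per unit
    of weight given to \<open>p\<close>.\<close>
  define \<delta> where "\<delta> p = - d $ p * v $ p" for p
  obtain i k l where ikl: "i \<noteq> k" "i \<noteq> l" "k \<noteq> l" and sorted: "\<delta> k \<le> \<delta> i" "\<delta> l \<le> \<delta> k"
    using sorted_players [of \<delta>] by blast
  have UNIV: "UNIV = {i, k, l}"
    by (rule UNIV_3_distinct [OF ikl])
  \<comment> \<open>Greedy choice: among its best players, each good goes to one with the largest
    \<open>\<delta>\<close>.\<close>
  define w where "w j = (if best_for a v i j then i else if best_for a v k j then k else l)" for j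
  have w: "best_for a v (w j) j" for j
    using ex_best_for [of a v j] UNIV by (auto simp: w_def)
  have value_w: "a $ w j $ j = top_ratio a v j * v $ w j" for j
    using w [of j] v [of "w j"] by (simp add: best_for_iff field_simps)
  define X :: "real ^ 'm ^ 3" where "X = (\<chi> i j. if i = w j then 1 else 0)"
  define y where "y = utility a X"
  have y: "(\<Sum>p\<in>UNIV. c $ p * y $ p) = (\<Sum>j\<in>UNIV. top_ratio a v j * (c $ w j * v $ w j))" for c
    unfolding y_def weighted_utility by (simp add: X_def value_w if_distrib mult.commute mult.left_commute cong: if_cong)
  have "is_allocation X"
    by (simp add: is_allocation_def X_def)
  then have "y \<in> IPS a"
    by (auto simp: IPS_def y_def)
  define C where "C = (\<Sum>p\<in>UNIV. 1 / v $ p)"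
  have C: "0 < C"
    unfolding C_def using v by (intro sum_pos) auto
  have "(\<Sum>p\<in>UNIV. RD v $ p * y $ p) = ?G"
  proof -
    have "RD v $ p * v $ p = 1 / C" for p
      using v [of p] by (simp add: RD_component flip: C_def)
    then show ?thesis
      unfolding y using v by (simp add: g_tilde_eq flip: C_def sum_divide_distrib)
  qed
  then have "y \<in> pareto_face a v"
    using \<open>y \<in> IPS a\<close> by (simp add: pareto_face_def support_plane_def g_tilde_def)
  then have "b < d \<bullet> y"
    by (rule d(2))
  moreover have "d \<bullet> y = - (\<Sum>j\<in>UNIV. top_ratio a v j * \<delta> (w j))"
    unfolding inner_vec_def inner_real_def y by (simp add: \<delta>_def sum_negf)
  moreover have "d \<bullet> (?G *\<^sub>R (\<chi> i. 1)) = - ?G * (\<delta> i / v $ i + \<delta> k / v $ k + \<delta> l / v $ l)"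
    using ikl v [of i] v [of k] v [of l] by (simp add: inner_vec_def UNIV \<delta>_def algebra_simps)
  moreover have "?G * (\<delta> i / v $ i + \<delta> k / v $ k + \<delta> l / v $ l) \<le> (\<Sum>j\<in>UNIV. top_ratio a v j * \<delta> (w j))"
  proof -
    define I where "I X = (\<Sum>j\<in>UNIV. if X j then top_ratio a v j else 0)" for X
    have I: "(\<Sum>j | X j. top_ratio a v j) = I X" for X
      by (simp add: I_def sum.If_cases)
    have all: "?G * (1 / v $ i + 1 / v $ k + 1 / v $ l) = I (\<lambda>_. True)"
    proof -
      have "C = 1 / v $ i + 1 / v $ k + 1 / v $ l"
        using ikl by (simp add: C_def UNIV)
      then show ?thesis
        using C v by (simp add: I_def g_tilde_eq flip: C_def)
    qed
    \<comment> \<open>Abel summation over the sorted players: the differences are nonnegative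
      multipliers of demand inequalities, while \<open>\<delta> l\<close>, of unknown sign,
      multiplies the equality \<open>all\<close>.\<close>
    have "?G * (\<delta> i / v $ i + \<delta> k / v $ k + \<delta> l / v $ l)
        = (\<delta> i - \<delta> k) * (?G * (1 / v $ i)) + (\<delta> k - \<delta> l) * (?G * (1 / v $ i + 1 / v $ k))
          + \<delta> l * (?G * (1 / v $ i + 1 / v $ k + 1 / v $ l))"
      by (simp add: algebra_simps diff_divide_distrib)
    also have "\<dots> \<le> (\<delta> i - \<delta> k) * I (best_for a v i)
        + (\<delta> k - \<delta> l) * I (\<lambda>j. best_for a v i j \<or> best_for a v k j) + \<delta> l * I (\<lambda>_. True)"
      unfolding all using single [of i] pair [OF ikl(1)] sorted
      by (intro add_mono order_refl mult_left_mono) (auto simp: I)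
    also have "\<dots> = (\<Sum>j\<in>UNIV. top_ratio a v j * \<delta> (w j))"
      unfolding I_def sum_distrib_left sum.distrib [symmetric]
      by (intro sum.cong) (auto simp: w_def algebra_simps)
    finally show ?thesis .
  qed
  ultimately show False
    using d(1) by simp
qed

end

theorem theorem7:
  fixes a :: "real ^ 'm::finite ^ 3" and vstar :: "real ^ 3"
  assumes normalized: "\<forall>i. (\<Sum>j\<in>UNIV. a $ i $ j) = 1"
    and MAC: "\<forall>i j. a $ i $ j > 0"
    and vstar: "vstar \<in> graph_vertices a"
  shows "(pareto_face a vstar \<inter> egalitarian_ray \<noteq> {} \<longrightarrow>
            (\<forall>v\<in>graph_vertices a. g_tilde a vstar \<le> g_tilde a v))
       \<and> ((\<forall>v'\<in>graph_vertices a. graph_adjacent a vstar v' \<longrightarrow> g_tilde a vstar \<le> g_tilde a v') \<longrightarrow>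
            pareto_face a vstar \<inter> egalitarian_ray \<noteq> {}
            \<and> (\<forall>v\<in>graph_vertices a. g_tilde a vstar \<le> g_tilde a v))"
proof -
  interpret positive_valuation a
    using MAC by unfold_locales blast
  have global: "\<forall>v\<in>graph_vertices a. g_tilde a vstar \<le> g_tilde a v"
    if egal: "pareto_face a vstar \<inter> egalitarian_ray \<noteq> {}"
  proof
    obtain t where t: "t *\<^sub>R (\<chi> i. 1) \<in> pareto_face a vstar"
      using egal by (auto simp: egalitarian_ray_def)
    \<comment> \<open>The weights \<open>RD v\<close> sum to 1, so the egalitarian point has
      weighted value \<open>t\<close> at every vertex: this equals \<open>g_tilde\<close> at
      \<open>vstar\<close> and bounds it from below elsewhere.\<close>
    have weighted: "(\<Sum>i\<in>UNIV. RD v $ i * (t *\<^sub>R (\<chi> i. 1) :: real ^ 3) $ i) = t"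
      if "v \<in> graph_vertices a" for v
      using sum_RD [of v] graph_vertex_pos(1) [OF that] by (simp flip: sum_distrib_right)
    fix v
    assume v: "v \<in> graph_vertices a"
    have "g_tilde a vstar = t"
      using t weighted [OF vstar] by (simp add: pareto_face_def support_plane_def g_tilde_def)
    also have "\<dots> \<le> g_tilde a v"
      using t support_value_upper [of "t *\<^sub>R (\<chi> i. 1)" a "RD v"]
      unfolding weighted [OF v] by (simp add: pareto_face_def g_tilde_def)
    finally show "g_tilde a vstar \<le> g_tilde a v" .
  qed
  have egal: "pareto_face a vstar \<inter> egalitarian_ray \<noteq> {}"
    if local: "\<forall>v'\<in>graph_vertices a. graph_adjacent a vstar v' \<longrightarrow> g_tilde a vstar \<le> g_tilde a v'"
  proof -
    have local_min: "g_tilde a vstar \<le> g_tilde a w" if "graph_adjacent a vstar w" for w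
      using local that by (simp add: graph_adjacent_def)
    have "g_tilde a vstar *\<^sub>R (\<chi> i. 1) \<in> pareto_face a vstar"
    proof (rule egalitarian_if_demand [OF graph_vertex_pos(1) [OF vstar]])
      show "g_tilde a vstar * (1 / vstar $ i) \<le> (\<Sum>j | best_for a vstar i j. top_ratio a vstar j)" for i
        using other_players [of i] graph_vertex_demand(2) [OF vstar local_min] by metis
      show "g_tilde a vstar * (1 / vstar $ k + 1 / vstar $ l)
          \<le> (\<Sum>j | best_for a vstar k j \<or> best_for a vstar l j. top_ratio a vstar j)" if "k \<noteq> l" for k l
        using third_player [OF that] graph_vertex_demand(1) [OF vstar local_min] that by metis
    qed
    moreover have "0 \<le> g_tilde a vstar"
      using vstar by (intro g_tilde_nonneg graph_vertex_pos(1))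
    ultimately show ?thesis
      unfolding egalitarian_ray_def by blast
  qed
  show ?thesis
    using global egal by blast
qed

end
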